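(* Any Walrasian economy $(m,\mathcal Z)$ which satisfies the weak axiom of revealed preferences (WARP) is variationally stable on any non-empty and compact price space $P\subseteq\mathbb{R}^m_+$.
   Context: A Walrasian economy $(m,\mathcal Z)$ consists of $m\in\mathbb N$ commodities and an excess demand correspondence $\mathcal Z:\mathbb{R}^m_+\rightrightarrows\mathbb{R}^m$. It satisfies WARP if for all $p,q\in\mathbb{R}^m_+$ and all $z_p\in\mathcal Z(p)$, $z_q\in\mathcal Z(q)$: $\langle z_q,p\rangle\le\langle z_q,q\rangle$ and $z_p\ne z_q$ together imply $\langle z_p,q\rangle>\langle z_p,p\rangle$. It is variationally stable on $P\subseteq\mathbb R^m_+$ if there exists $p^*\in P$ such that $\langle z,p^*-p\rangle\ge0$ for all $p\in P$ and all $z\in\mathcal Z(p)$.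
   Formalization: The price space P is additionally assumed convex and the excess demand correspondence is assumed to have non-empty values on P; without either assumption the claim is false. *)

theory Defs
  imports "HOL-Analysis.Analysis"
begin

text \<open>The number of commodities is the cardinality of the index type \<open>'m\<close>. An excess demand
  correspondence is a set-valued map on \<open>real ^ 'm\<close> of which only the values on the nonnegative
  orthant are ever used.\<close>

definition nonneg_orthant :: "(real ^ 'm) set" where
  "nonneg_orthant = {p. \<forall>i. 0 \<le> p $ i}"

definition WARP :: "(real ^ 'm \<Rightarrow> (real ^ 'm) set) \<Rightarrow> bool" where
  "WARP Z \<longleftrightarrow>
    (\<forall>p\<in>nonneg_orthant. \<forall>q\<in>nonneg_orthant. \<forall>zp\<in>Z p. \<forall>zq\<in>Z q.
      zq \<bullet> p \<le> zq \<bullet> q \<and> zp \<noteq> zq \<longrightarrow> zp \<bullet> q > zp \<bullet> p)"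

definition variationally_stable_on ::
    "(real ^ 'm \<Rightarrow> (real ^ 'm) set) \<Rightarrow> (real ^ 'm) set \<Rightarrow> bool" where
  "variationally_stable_on Z P \<longleftrightarrow>
    (\<exists>p'\<in>P. \<forall>p\<in>P. \<forall>z\<in>Z p. z \<bullet> (p' - p) \<ge> 0)"

end

theory Submission
  imports Defs
begin

text \<open>The conditions \<open>0 \<le> z \<bullet> (x - p)\<close> cut out closed subsets of the compact set \<open>P\<close>, so it suffices to
  satisfy finitely many of them at once. To this end pull \<open>x\<close> towards each \<open>p\<close> whose condition fails,
  with weight equal to the violation. At a Brouwer fixed point \<open>x\<close> the weighted sum of the
  displacements \<open>p - x\<close> vanishes, whereas by WARP every excess demand at \<open>x\<close> has a positive inner
  product with each displacement of positive weight. Hence no condition fails at \<open>x\<close>.\<close>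

text \<open>If all weights vanish the point is \<open>x\<close>; otherwise it is a convex
  combination of \<open>x\<close> and the \<open>w\<close>-weighted mean of the
  \<open>y k\<close>.\<close>

lemma convex_weighted_mean:
  fixes P :: "'a::real_vector set" and w :: "'i \<Rightarrow> real"
  assumes P: "convex P" and K: "finite K" and x: "x \<in> P"
    and y: "\<And>k. k \<in> K \<Longrightarrow> y k \<in> P" and w: "\<And>k. k \<in> K \<Longrightarrow> 0 \<le> w k"
  shows "(x + (\<Sum>k\<in>K. w k *\<^sub>R y k)) /\<^sub>R (1 + sum w K) \<in> P"
proof (cases "sum w K = 0")
  case True
  then have "w k = 0" if "k \<in> K" for k
    using that K w sum_nonneg_eq_0_iff by metis
  then show ?thesis using x by simp
next
  case False
  have W: "0 < sum w K" using False w by (simp add: order_less_le sum_nonneg)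
  define m where "m = (\<Sum>k\<in>K. (w k / sum w K) *\<^sub>R y k)"
  have "m \<in> P" unfolding m_def
    using K P y w W by (intro convex_sum) (auto simp flip: sum_divide_distrib)
  moreover have "(\<Sum>k\<in>K. w k *\<^sub>R y k) = sum w K *\<^sub>R m"
    using W by (simp add: m_def scaleR_sum_right)
  moreover have "1 / (1 + sum w K) + sum w K / (1 + sum w K) = 1"
    using W by (simp flip: add_divide_distrib)
  ultimately show ?thesis
    using convexD[OF P x, of m "1 / (1 + sum w K)" "sum w K / (1 + sum w K)"] W
    by (simp add: scaleR_add_right divide_inverse mult.commute)
qed

text \<open>When \<open>zx = zp\<close>, WARP says nothing, but the conclusion is then the hypothesis itself.\<close>

lemma WARP_strict:
  assumes "WARP Z" "x \<in> nonneg_orthant" "p \<in> nonneg_orthant" "zx \<in> Z x" "zp \<in> Z p"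
    and "zp \<bullet> (x - p) < 0"
  shows "zx \<bullet> (p - x) > 0"
  using assms unfolding WARP_def inner_diff_right
  by (cases "zx = zp") (simp, metis diff_gt_0_iff_gt less_iff_diff_less_0 less_imp_le)

lemma WARP_finitely_many:
  fixes P :: "(real ^ 'm) set"
  assumes warp: "WARP Z" and P: "P \<subseteq> nonneg_orthant" "P \<noteq> {}" "compact P" "convex P"
    and ne: "\<And>p. p \<in> P \<Longrightarrow> Z p \<noteq> {}"
    and K: "finite K" "K \<subseteq> Sigma P Z"
  shows "\<exists>x\<in>P. \<forall>(p, z)\<in>K. 0 \<le> z \<bullet> (x - p)"
proof -
  define w where "w = (\<lambda>x (k :: (real ^ 'm) \<times> (real ^ 'm)). max 0 (snd k \<bullet> (fst k - x)))"
  \<comment> \<open>The point \<open>x\<close> itself has weight 1, so the denominator stays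
    positive even when no condition fails.\<close>
  define f where "f x = (x + (\<Sum>k\<in>K. w x k *\<^sub>R fst k)) /\<^sub>R (1 + sum (w x) K)" for x
  have w_nonneg: "0 \<le> w x k" for x k by (simp add: w_def)
  have W: "1 + sum (w x) K > 0" for x
    by (simp add: add_pos_nonneg sum_nonneg w_nonneg)
  have cont: "continuous_on P (\<lambda>x. w x k)" for k
    unfolding w_def by (intro continuous_intros)
  have "continuous_on P f"
    unfolding f_def using W by (intro continuous_intros cont) (metis less_irrefl)
  moreover have "f \<in> P \<rightarrow> P"
    unfolding f_def using K by (intro funcsetI convex_weighted_mean P w_nonneg) auto
  ultimately obtain x where x: "x \<in> P" "f x = x"
    using brouwer[OF P(3,4,2)] by blast
  \<comment> \<open>Clearing the denominator in \<open>f x = x\<close> cancels the lone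
    \<open>x\<close> and leaves the balance of displacements.\<close>
  have "x + (\<Sum>k\<in>K. w x k *\<^sub>R fst k) = (1 + sum (w x) K) *\<^sub>R f x"
    using W[of x] by (simp add: f_def)
  then have balance: "(\<Sum>k\<in>K. w x k *\<^sub>R (fst k - x)) = 0"
    by (simp add: x(2) algebra_simps sum_subtractf scaleR_sum_left)
  \<comment> \<open>A single excess demand at \<open>x\<close> tests all displacements
    simultaneously.\<close>
  obtain zx where zx: "zx \<in> Z x" using ne x(1) by blast
  have strict: "0 < zx \<bullet> (fst k - x)" if "k \<in> K" "0 < w x k" for k
  proof (rule WARP_strict[OF warp])
    show "snd k \<bullet> (x - fst k) < 0"
      using that(2) by (simp add: w_def inner_diff_right)
    show "x \<in> nonneg_orthant" "zx \<in> Z x" using x(1) P(1) zx by auto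
    show "fst k \<in> nonneg_orthant" "snd k \<in> Z (fst k)" using that(1) K(2) P(1) by fastforce+
  qed
  have term_nonneg: "0 \<le> w x k * (zx \<bullet> (fst k - x))" if "k \<in> K" for k
    using strict[OF that] w_nonneg[of x k] by (cases "w x k = 0") auto
  \<comment> \<open>Pairing \<open>balance\<close> with \<open>zx\<close> yields a zero sum of
    nonnegative terms, so each term vanishes.\<close>
  have "(\<Sum>k\<in>K. w x k * (zx \<bullet> (fst k - x))) = zx \<bullet> (\<Sum>k\<in>K. w x k *\<^sub>R (fst k - x))"
    by (simp add: inner_sum_right)
  then have "w x k * (zx \<bullet> (fst k - x)) = 0" if "k \<in> K" for k
    using that balance term_nonneg K(1) by (simp add: sum_nonneg_eq_0_iff)
  then have "w x k = 0" if "k \<in> K" for k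
    using that strict[of k] w_nonneg[of x k] by fastforce
  then have "\<forall>(p, z)\<in>K. 0 \<le> z \<bullet> (x - p)"
    by (force simp: w_def inner_diff_right max_def split: if_splits)
  then show ?thesis using x(1) by blast
qed

theorem corollaryF5:
  fixes Z :: "real ^ 'm \<Rightarrow> (real ^ 'm) set"
    and P :: "(real ^ 'm) set"
  assumes "WARP Z"
    and "P \<subseteq> nonneg_orthant"
    and "P \<noteq> {}"
    and "compact P"
    and "convex P"
    and "\<And>p. p \<in> P \<Longrightarrow> Z p \<noteq> {}"
  shows "variationally_stable_on Z P"
proof -
  \<comment> \<open>One half-space per pair of a price and an excess demand there, so a finite
    subfamily involves only finitely many values of \<open>Z\<close> even if \<open>Z p\<close> is
    infinite.\<close>
  define C where "C = (\<lambda>(p, z). {x :: real ^ 'm. 0 \<le> z \<bullet> (x - p)})"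
  have "P \<inter> (\<Inter>k\<in>Sigma P Z. C k) \<noteq> {}"
  proof (rule compact_imp_fip_image[OF \<open>compact P\<close>])
    show "closed (C k)" for k
      unfolding C_def by (cases k) (auto intro!: closed_Collect_le continuous_intros)
  next
    fix K assume "finite K" "K \<subseteq> Sigma P Z"
    from WARP_finitely_many[OF assms this] show "P \<inter> (\<Inter>k\<in>K. C k) \<noteq> {}"
      by (fastforce simp: C_def)
  qed
  then show ?thesis
    unfolding variationally_stable_on_def C_def by fastforce
qed

end
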